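(* Consider the constrained deterministic optimal control problem of minimizing $G(T)$ over complete trajectories $T\in C$ in the multiagent case, where each control has $m$ components $u_k=(u_k^1,\ldots,u_k^m)\in U_k^1\times\cdots\times U_k^m$ and each set $U_k^\ell$ has at most $n$ elements, together with a base heuristic $R$ for the reformulated (one-component-at-a-time) problem and the multiagent rollout algorithm, all as defined in the context. Assume that the base heuristic is sequentially improving for the reformulated problem and generates a feasible complete trajectory starting from the initial state $\tilde y_0=\tilde x_0$, i.e., $R(\tilde y_0)\in C$. Then the multiagent rollout algorithm produces a complete trajectory $\tilde y_N$ that is feasible and has the cost improvement property $$G(\tilde y_N)\le G\big(R(\tilde y_0)\big),$$ and it requires order $O(nm)$ applications of the base heuristic per stage.
   Context: Problem. Let $N\ge1$, $m\ge 1$. For $k=0,\ldots,N-1$ there is a system equation $x_{k+1}=f_k(x_k,u_k)$, where $x_k$ is the state, $u_k=(u_k^1,\ldots,u_k^m)$ is the control, with components $u_k^\ell$ in given finite nonempty sets $U_k^\ell$ having at most $n$ elements each, and $f_k$ is a given function. The initial state $\tilde x_0$ is given. A complete trajectory is a sequence $T=(x_0,u_0,x_1,u_1,\ldots,u_{N-1},x_N)$ with $x_0=\tilde x_0$ and $x_{k+1}=f_k(x_k,u_k)$ for all $k$. $G$ is a given real-valued cost function of complete trajectories and $C$ is a given set of complete trajectories; a complete trajectory is called feasible if it belongs to $C$. Reformulated problem. Between $x_k$ and $x_{k+1}=f_k(x_k,u_k)$ one introduces the intermediate states $(x_k,u_k^1),(x_k,u_k^1,u_k^2),\ldots,(x_k,u_k^1,\ldots,u_k^{m-1})$,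 so that the components $u_k^1,\ldots,u_k^m$ are chosen one at a time, in this order. A partial trajectory of the reformulated problem is identified with a sequence $$z=(x_0,u_0,x_1,\ldots,u_{k-1},x_k,u_k^1,\ldots,u_k^{\ell-1}),\qquad 0\le k\le N-1,\ 1\le\ell\le m,$$ that starts at the given initial state and satisfies the system equation (for $\ell=1$ no component of $u_k$ has been chosen yet), or with a complete trajectory. The successor of $z$ under the choice $u_k^\ell\in U_k^\ell$, denoted $z^+(u_k^\ell)$, is obtained by appending $u_k^\ell$ to $z$ and, if $\ell=m$, also appending $x_{k+1}=f_k(x_k,u_k)$. Base heuristic. A base heuristic is a map $R$ that, from any partial trajectory $z$ of the reformulated problem, generates a complementary partial trajectory $R(z)$, i.e., values of all the remaining control components up to stage $N-1$ and the corresponding states given by the system equation. $z\cup R(z)$ denotes the resulting complete trajectory (equal to $z$ if $z$ is already complete); $R(\tilde y_0)$ also denotes the complete trajectory generated from the initial state $\tilde y_0=\tilde x_0$. For $z$ as displayed and $u_k^\ell\in U_k^\ell$, let $T_k^\ell(z,u_k^\ell)=z^+(u_k^\ell)\cup R\big(z^+(u_k^\ell)\big)$ and $U_k^\ell(z)=\{u_k^\ell\in U_k^\ell\mid T_k^\ell(z,u_k^\ell)\in C\}$. The base heuristic is sequentially improving for the reformulated problem if for every $k=0,\ldots,N-1$, $\ell=1,\ldots,m$, and every partial trajectory $z$ as displayed for which $z\cup R(z)\in C$, the set $U_k^\ell(z)$ is nonempty and $$G\big(z\cup R(z)\big)\ge\min_{u_k^\ell\in U_k^\ell(z)}G\big(T_k^\ell(z,u_k^\ell)\big).$$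 Multiagent rollout algorithm. Starting from $z=\tilde y_0=\tilde x_0$, for each stage $k=0,\ldots,N-1$ and, within the stage, for each $\ell=1,\ldots,m$ in order, given the current partial trajectory $z=(\tilde x_0,\tilde u_0,\ldots,\tilde x_k,\tilde u_k^1,\ldots,\tilde u_k^{\ell-1})$, the algorithm runs the base heuristic once from $z^+(u_k^\ell)$ for each $u_k^\ell\in U_k^\ell$, selects (with arbitrary tie-breaking) $\tilde u_k^\ell\in\arg\min_{u_k^\ell\in U_k^\ell(z)}G\big(T_k^\ell(z,u_k^\ell)\big)$, and replaces $z$ by $z^+(\tilde u_k^\ell)$. The final complete trajectory is denoted $\tilde y_N$. *)

theory Defs
  imports Complex_Main "HOL-Library.Multiset"
begin

text \<open>Stages are numbered from 0, control components from 1. A trajectory is the flat sequence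
  of the states and control components chosen so far, in the order in which they are determined.\<close>

datatype ('x, 'u) entry = State (state_of: 'x) | Ctrl (ctrl_of: 'u)

type_synonym ('x, 'u) trajectory = "('x, 'u) entry list"

text \<open>The control vector of a stage is the list of its \<open>agents P\<close> components. The values of
  \<open>cost\<close> outside the complete trajectories, of \<open>dyn\<close> at stages beyond the horizon or at lists of
  another length, and of \<open>ctrl_set\<close> outside the index range are irrelevant.\<close>

record ('x, 'u) control_problem =
  horizon :: nat
  agents :: nat
  initial_state :: 'x
  ctrl_set :: "nat \<Rightarrow> nat \<Rightarrow> 'u set"
  dyn :: "nat \<Rightarrow> 'x \<Rightarrow> 'u list \<Rightarrow> 'x"
  cost :: "('x, 'u) trajectory \<Rightarrow> real"
  constraint_set :: "('x, 'u) trajectory set"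

text \<open>The sequence \<open>(x 0, u 0, x 1, \<dots>, u (k - 1), x k, u k 1, \<dots>, u k (l - 1))\<close>.\<close>

definition trajectory_of ::
  "nat \<Rightarrow> (nat \<Rightarrow> 'x) \<Rightarrow> (nat \<Rightarrow> nat \<Rightarrow> 'u) \<Rightarrow> nat \<Rightarrow> nat \<Rightarrow> ('x, 'u) trajectory" where
  "trajectory_of m x u k l =
     concat (map (\<lambda>i. State (x i) # map (\<lambda>j. Ctrl (u i j)) [1..<Suc m]) [0..<k])
     @ State (x k) # map (\<lambda>j. Ctrl (u k j)) [1..<l]"

definition admissible_at ::
  "('x, 'u) control_problem \<Rightarrow> nat \<Rightarrow> nat \<Rightarrow> ('x, 'u) trajectory \<Rightarrow> bool" where
  "admissible_at P k l z \<longleftrightarrow>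
     (\<exists>x u. x 0 = initial_state P \<and>
        (\<forall>i<k. x (Suc i) = dyn P i (x i) (map (u i) [1..<Suc (agents P)])) \<and>
        (\<forall>i<k. \<forall>j\<in>{1..agents P}. u i j \<in> ctrl_set P i j) \<and>
        (\<forall>j\<in>{1..<l}. u k j \<in> ctrl_set P k j) \<and>
        z = trajectory_of (agents P) x u k l)"

definition partial_trajectory ::
  "('x, 'u) control_problem \<Rightarrow> nat \<Rightarrow> nat \<Rightarrow> ('x, 'u) trajectory \<Rightarrow> bool" where
  "partial_trajectory P k l z \<longleftrightarrow>
     k < horizon P \<and> 1 \<le> l \<and> l \<le> agents P \<and> admissible_at P k l z"

definition complete_trajectory ::
  "('x, 'u) control_problem \<Rightarrow> ('x, 'u) trajectory \<Rightarrow> bool" where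
  "complete_trajectory P z \<longleftrightarrow> admissible_at P (horizon P) 1 z"

definition initial_trajectory :: "('x, 'u) control_problem \<Rightarrow> ('x, 'u) trajectory" where
  "initial_trajectory P = [State (initial_state P)]"

text \<open>In a trajectory at position \<open>(k, l)\<close> each earlier stage takes up \<open>agents P + 1\<close> entries, so
  \<open>x k\<close> has index \<open>k * (agents P + 1)\<close> and the chosen components of \<open>u k\<close> come after it.\<close>

definition successor ::
  "('x, 'u) control_problem \<Rightarrow> nat \<Rightarrow> nat \<Rightarrow> ('x, 'u) trajectory \<Rightarrow> 'u \<Rightarrow> ('x, 'u) trajectory" where
  "successor P k l z v =
     (let p = k * (agents P + 1) in
      z @ [Ctrl v] @
      (if l = agents P
       then [State (dyn P k (state_of (z ! p)) (map ctrl_of (drop (p + 1) z) @ [v]))]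
       else []))"

text \<open>A complete \<open>z\<close> is covered by the second clause: all complete trajectories have the same
  length, so it forces \<open>R z = []\<close>.\<close>

definition base_heuristic ::
  "('x, 'u) control_problem \<Rightarrow> (('x, 'u) trajectory \<Rightarrow> ('x, 'u) trajectory) \<Rightarrow> bool" where
  "base_heuristic P R \<longleftrightarrow>
     (\<forall>k l z. partial_trajectory P k l z \<longrightarrow> complete_trajectory P (z @ R z)) \<and>
     (\<forall>z. complete_trajectory P z \<longrightarrow> complete_trajectory P (z @ R z))"

definition heuristic_completion ::
  "(('x, 'u) trajectory \<Rightarrow> ('x, 'u) trajectory) \<Rightarrow> ('x, 'u) trajectory \<Rightarrow> ('x, 'u) trajectory" where
  "heuristic_completion R z = z @ R z"

definition candidate ::
  "('x, 'u) control_problem \<Rightarrow> (('x, 'u) trajectory \<Rightarrow> ('x, 'u) trajectory) \<Rightarrow>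
   nat \<Rightarrow> nat \<Rightarrow> ('x, 'u) trajectory \<Rightarrow> 'u \<Rightarrow> ('x, 'u) trajectory" where
  "candidate P R k l z v = heuristic_completion R (successor P k l z v)"

definition feasible_ctrls ::
  "('x, 'u) control_problem \<Rightarrow> (('x, 'u) trajectory \<Rightarrow> ('x, 'u) trajectory) \<Rightarrow>
   nat \<Rightarrow> nat \<Rightarrow> ('x, 'u) trajectory \<Rightarrow> 'u set" where
  "feasible_ctrls P R k l z = {v \<in> ctrl_set P k l. candidate P R k l z v \<in> constraint_set P}"

definition sequentially_improving ::
  "('x, 'u) control_problem \<Rightarrow> (('x, 'u) trajectory \<Rightarrow> ('x, 'u) trajectory) \<Rightarrow> bool" where
  "sequentially_improving P R \<longleftrightarrow>
     (\<forall>k l z. partial_trajectory P k l z \<and> heuristic_completion R z \<in> constraint_set P \<longrightarrow>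
        feasible_ctrls P R k l z \<noteq> {} \<and>
        cost P (heuristic_completion R z)
          \<ge> Min ((\<lambda>v. cost P (candidate P R k l z v)) ` feasible_ctrls P R k l z))"

definition minimizing_ctrls ::
  "('x, 'u) control_problem \<Rightarrow> (('x, 'u) trajectory \<Rightarrow> ('x, 'u) trajectory) \<Rightarrow>
   nat \<Rightarrow> nat \<Rightarrow> ('x, 'u) trajectory \<Rightarrow> 'u set" where
  "minimizing_ctrls P R k l z =
     {v. is_arg_min (\<lambda>v. cost P (candidate P R k l z v)) (\<lambda>v. v \<in> feasible_ctrls P R k l z) v}"

text \<open>A tie-breaking rule may depend on the whole current trajectory; every run of the rollout
  algorithm with arbitrary choices among the minimizers follows such a rule.\<close>

definition tie_breaking :: "(('x, 'u) trajectory \<Rightarrow> 'u set \<Rightarrow> 'u) \<Rightarrow> bool" where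
  "tie_breaking sel \<longleftrightarrow> (\<forall>z A. A \<noteq> {} \<longrightarrow> sel z A \<in> A)"

text \<open>One step of the algorithm. Along with the next trajectory it returns the multiset of the
  trajectories from which the base heuristic is run, one run for each element of the control set.
  It fails if there is no feasible control to select.\<close>

definition rollout_step ::
  "('x, 'u) control_problem \<Rightarrow> (('x, 'u) trajectory \<Rightarrow> ('x, 'u) trajectory) \<Rightarrow>
   (('x, 'u) trajectory \<Rightarrow> 'u set \<Rightarrow> 'u) \<Rightarrow> nat \<Rightarrow> nat \<Rightarrow> ('x, 'u) trajectory \<Rightarrow>
   (('x, 'u) trajectory \<times> ('x, 'u) trajectory multiset) option" where
  "rollout_step P R sel k l z =
     (let A = minimizing_ctrls P R k l z in
      if A = {} then None
      else Some (successor P k l z (sel z A),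
                 image_mset (successor P k l z) (mset_set (ctrl_set P k l))))"

text \<open>The first \<open>l\<close> component selections of stage \<open>k\<close>, starting from \<open>z\<close>.\<close>

primrec rollout_stage ::
  "('x, 'u) control_problem \<Rightarrow> (('x, 'u) trajectory \<Rightarrow> ('x, 'u) trajectory) \<Rightarrow>
   (('x, 'u) trajectory \<Rightarrow> 'u set \<Rightarrow> 'u) \<Rightarrow> nat \<Rightarrow> ('x, 'u) trajectory \<Rightarrow> nat \<Rightarrow>
   (('x, 'u) trajectory \<times> ('x, 'u) trajectory multiset) option" where
  "rollout_stage P R sel k z 0 = Some (z, {#})"
| "rollout_stage P R sel k z (Suc l) =
     Option.bind (rollout_stage P R sel k z l) (\<lambda>(z', Q).
       map_option (\<lambda>(z'', Q'). (z'', Q + Q')) (rollout_step P R sel k (Suc l) z'))"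

text \<open>The first \<open>k\<close> stages. The second component lists, stage by stage, the multisets of the
  trajectories from which the base heuristic is run.\<close>

primrec rollout_upto ::
  "('x, 'u) control_problem \<Rightarrow> (('x, 'u) trajectory \<Rightarrow> ('x, 'u) trajectory) \<Rightarrow>
   (('x, 'u) trajectory \<Rightarrow> 'u set \<Rightarrow> 'u) \<Rightarrow> nat \<Rightarrow>
   (('x, 'u) trajectory \<times> ('x, 'u) trajectory multiset list) option" where
  "rollout_upto P R sel 0 = Some (initial_trajectory P, [])"
| "rollout_upto P R sel (Suc k) =
     Option.bind (rollout_upto P R sel k) (\<lambda>(z, Qs).
       map_option (\<lambda>(z', Q). (z', Qs @ [Q])) (rollout_stage P R sel k z (agents P)))"

definition multiagent_rollout ::
  "('x, 'u) control_problem \<Rightarrow> (('x, 'u) trajectory \<Rightarrow> ('x, 'u) trajectory) \<Rightarrow>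
   (('x, 'u) trajectory \<Rightarrow> 'u set \<Rightarrow> 'u) \<Rightarrow>
   (('x, 'u) trajectory \<times> ('x, 'u) trajectory multiset list) option" where
  "multiagent_rollout P R sel = rollout_upto P R sel (horizon P)"

end

(* The quantity G (z \<union> R z) does not increase along the run and z \<union> R z stays feasible: by sequential
   improvement the minimum over the feasible components is attained and is at most G (z \<union> R z), and
   the selected candidate is z' \<union> R z' for the next trajectory z'. At the end R z is empty. *)

theory Submission
  imports Defs
begin

lemma length_stages:
  "length (concat (map (\<lambda>i. State (x i) # map (\<lambda>j. Ctrl (u i j)) [1..<Suc m]) [0..<k])) = k * (m + 1)"
  by (induction k) simp_all

text \<open>The last stage contributes \<open>x k\<close> and \<open>l - 1\<close> components. The
  premise excludes \<open>l = 0\<close>, where \<open>[1..<0]\<close> is empty and the list is the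
  same as for \<open>l = 1\<close>.\<close>

lemma length_trajectory_of:
  "1 \<le> l \<Longrightarrow> length (trajectory_of m x u k l) = k * (m + 1) + l"
  unfolding trajectory_of_def length_append length_stages by simp

text \<open>Whatever lies beyond position \<open>(k, l)\<close> does not enter the list, so the
  describing functions may be overwritten there without changing the trajectory.\<close>

lemma trajectory_of_cong:
  fixes x x' :: "nat \<Rightarrow> 'x" and u u' :: "nat \<Rightarrow> nat \<Rightarrow> 'u"
  assumes "\<And>i. i \<le> k \<Longrightarrow> x i = x' i"
    and "\<And>i j. i < k \<Longrightarrow> 1 \<le> j \<Longrightarrow> j \<le> m \<Longrightarrow> u i j = u' i j"
    and "\<And>j. 1 \<le> j \<Longrightarrow> j < l \<Longrightarrow> u k j = u' k j"
  shows "trajectory_of m x u k l = trajectory_of m x' u' k l"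
proof -
  have "map (\<lambda>i. State (x i) # map (\<lambda>j. Ctrl (u i j)) [1..<Suc m]) [0..<k]
      = map (\<lambda>i. State (x' i) # map (\<lambda>j. Ctrl (u' i j)) [1..<Suc m]) [0..<k]"
    using assms(1,2) by (intro map_cong) (auto simp del: upt_Suc)
  moreover have "map (\<lambda>j. Ctrl (u k j) :: ('x, 'u) entry) [1..<l] = map (\<lambda>j. Ctrl (u' k j)) [1..<l]"
    using assms(3) by (intro map_cong) auto
  ultimately show ?thesis
    using assms(1)[of k] by (simp only: trajectory_of_def)
qed

lemma trajectory_of_Suc_component:
  "1 \<le> l \<Longrightarrow> trajectory_of m x u k (Suc l) = trajectory_of m x u k l @ [Ctrl (u k l)]"
  by (simp add: trajectory_of_def)

text \<open>The list at \<open>Suc m\<close> is an intermediate one: the control vector of stage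
  \<open>k\<close> is full, but the state it leads to is still missing.\<close>

lemma trajectory_of_Suc_stage:
  "trajectory_of m x u (Suc k) 1 = trajectory_of m x u k (Suc m) @ [State (x (Suc k))]"
  by (simp add: trajectory_of_def)

lemma state_trajectory_of: "trajectory_of m x u k l ! (k * (m + 1)) = State (x k)"
  unfolding trajectory_of_def nth_append length_stages by simp

lemma ctrls_trajectory_of:
  "map ctrl_of (drop (k * (m + 1) + 1) (trajectory_of m x u k l)) = map (u k) [1..<l]"
  unfolding trajectory_of_def drop_append length_stages
  by (simp add: length_stages drop_Cons' comp_def del: upt_Suc One_nat_def)

text \<open>Removes the index arithmetic from \<open>successor\<close>: the two preceding lemmas
  read off \<open>x k\<close> and the chosen components of \<open>u k\<close> from the flat
  list.\<close>

lemma successor_trajectory_of: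
  "successor P k l (trajectory_of (agents P) x u k l) v =
     trajectory_of (agents P) x u k l @ Ctrl v #
       (if l = agents P then [State (dyn P k (x k) (map (u k) [1..<l] @ [v]))] else [])"
  unfolding successor_def Let_def state_trajectory_of ctrls_trajectory_of by simp

text \<open>From the last component of the last stage this leads to \<open>(horizon P, 1)\<close>,
  the position of the complete trajectories.\<close>

definition next_position :: "nat \<Rightarrow> nat \<Rightarrow> nat \<Rightarrow> nat \<times> nat" where
  "next_position m k l = (if l < m then (k, Suc l) else (Suc k, 1))"

text \<open>The functions describing \<open>z\<close> are unconstrained beyond
  \<open>(k, l)\<close>, so they can be redefined there to describe the successor as well.\<close>

lemma admissible_at_successor:
  assumes "1 \<le> l" "l \<le> agents P" "admissible_at P k l z" "v \<in> ctrl_set P k l"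
  shows "case next_position (agents P) k l of (k', l') \<Rightarrow> admissible_at P k' l' (successor P k l z v)"
proof -
  let ?m = "agents P"
  from assms(3) obtain x u where x0: "x 0 = initial_state P"
    and dynx: "\<forall>i<k. x (Suc i) = dyn P i (x i) (map (u i) [1..<Suc ?m])"
    and ctrls: "\<forall>i<k. \<forall>j\<in>{1..?m}. u i j \<in> ctrl_set P i j"
    and last: "\<forall>j\<in>{1..<l}. u k j \<in> ctrl_set P k j"
    and z: "z = trajectory_of ?m x u k l"
    unfolding admissible_at_def by blast
  \<comment> \<open>The new component and the state after it are stored in the first free places.
    For \<open>l < agents P\<close> the value of \<open>x'\<close> at \<open>Suc k\<close> is a
    dummy that the successor does not contain.\<close>
  define u' where "u' = u(k := (u k)(l := v))"
  define x' where "x' = x(Suc k := dyn P k (x k) (map (u k) [1..<l] @ [v]))"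
  have z': "z = trajectory_of ?m x' u' k l"
    unfolding z by (rule trajectory_of_cong) (auto simp: u'_def x'_def)
  have row: "map (u' k) [1..<Suc l] = map (u k) [1..<l] @ [v]"
    using assms(1) by (simp add: u'_def)
  have dynx': "\<forall>i<k. x' (Suc i) = dyn P i (x' i) (map (u' i) [1..<Suc ?m])"
    using dynx by (auto simp: u'_def x'_def simp del: upt_Suc)
  have x0': "x' 0 = initial_state P"
    using x0 by (simp add: x'_def)
  have ctrls': "\<forall>i<k. \<forall>j\<in>{1..?m}. u' i j \<in> ctrl_set P i j"
    using ctrls by (simp add: u'_def)
  have last': "\<forall>j\<in>{1..<Suc l}. u' k j \<in> ctrl_set P k j"
    using last assms(4) by (auto simp: u'_def less_Suc_eq)
  have comp: "trajectory_of ?m x' u' k (Suc l) = z @ [Ctrl v]"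
    unfolding trajectory_of_Suc_component[OF assms(1)] z'[symmetric] by (simp add: u'_def)
  show ?thesis
  proof (cases "l < ?m")
    case True
    then have "successor P k l z v = trajectory_of ?m x' u' k (Suc l)"
      unfolding comp by (simp add: successor_def)
    then show ?thesis
      using True x0' dynx' ctrls' last' unfolding admissible_at_def next_position_def by auto
  next
    case False
    with assms(2) have l: "l = ?m" by simp
    have "successor P k l z v = z @ Ctrl v # [State (x' (Suc k))]"
      unfolding z successor_trajectory_of by (simp add: l x'_def)
    then have "successor P k l z v = trajectory_of ?m x' u' (Suc k) 1"
      unfolding trajectory_of_Suc_stage comp[unfolded l] by simp
    \<comment> \<open>At \<open>l = agents P\<close>, \<open>row\<close> says that appending
      \<open>v\<close> completes the control vector of stage \<open>k\<close>, which is the system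
      equation for the new state.\<close>
    moreover have "x' (Suc k) = dyn P k (x' k) (map (u' k) [1..<Suc ?m])"
      using row unfolding l x'_def by simp
    with dynx' have "\<forall>i<Suc k. x' (Suc i) = dyn P i (x' i) (map (u' i) [1..<Suc ?m])"
      by (simp only: All_less_Suc)
    moreover have "\<forall>i<Suc k. \<forall>j\<in>{1..?m}. u' i j \<in> ctrl_set P i j"
      using ctrls' last' unfolding l by (auto simp: less_Suc_eq)
    moreover have "\<forall>j\<in>{1..<1}. u' (Suc k) j \<in> ctrl_set P (Suc k) j" by simp
    ultimately have "admissible_at P (Suc k) 1 (successor P k l z v)"
      using x0' unfolding admissible_at_def by blast
    then show ?thesis
      using False by (simp add: next_position_def)
  qed
qed

lemma admissible_at_initial_trajectory: "admissible_at P 0 1 (initial_trajectory P)"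
  unfolding admissible_at_def initial_trajectory_def trajectory_of_def by auto

lemma length_complete_trajectory:
  assumes "complete_trajectory P z"
  shows "length z = horizon P * (agents P + 1) + 1"
  using assms length_trajectory_of[of 1]
  unfolding complete_trajectory_def admissible_at_def by blast

text \<open>Both \<open>z\<close> and \<open>z @ R z\<close> are complete, hence equally long. This
  transfers statements on the completion of the final trajectory to that trajectory itself.\<close>

lemma heuristic_completion_complete:
  assumes "base_heuristic P R" "complete_trajectory P z"
  shows "heuristic_completion R z = z"
proof -
  have "length (z @ R z) = length z"
    using assms length_complete_trajectory unfolding base_heuristic_def by metis
  then show ?thesis by (simp add: heuristic_completion_def)
qed

text \<open>The loop invariant. It uses \<open>admissible_at\<close> instead of
  \<open>partial_trajectory\<close> so that it also covers the final position
  \<open>(horizon P, 1)\<close>; the bound \<open>c\<close> stays fixed during the run.\<close>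

definition feasible_below ::
  "('x, 'u) control_problem \<Rightarrow> (('x, 'u) trajectory \<Rightarrow> ('x, 'u) trajectory) \<Rightarrow> real \<Rightarrow>
   nat \<times> nat \<Rightarrow> ('x, 'u) trajectory \<Rightarrow> bool" where
  "feasible_below P R c p z \<longleftrightarrow>
     admissible_at P (fst p) (snd p) z \<and> heuristic_completion R z \<in> constraint_set P \<and>
     cost P (heuristic_completion R z) \<le> c"

text \<open>The only place where sequential improvement is used: it keeps the step from failing and
  the bound \<open>c\<close> from being exceeded. The heuristic is run once per element of the
  control set, whence the exact count.\<close>

lemma rollout_step_feasible_below:
  assumes "sequentially_improving P R" "tie_breaking sel" "finite (ctrl_set P k l)"
    and "k < horizon P" "1 \<le> l" "l \<le> agents P" "feasible_below P R c (k, l) z"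
  shows "\<exists>z' Q. rollout_step P R sel k l z = Some (z', Q) \<and>
    feasible_below P R c (next_position (agents P) k l) z' \<and> size Q = card (ctrl_set P k l)"
proof -
  let ?F = "feasible_ctrls P R k l z" and ?f = "\<lambda>v. cost P (candidate P R k l z v)"
  let ?A = "minimizing_ctrls P R k l z" and ?c = "cost P (heuristic_completion R z)"
  have adm: "admissible_at P k l z" and feas: "heuristic_completion R z \<in> constraint_set P"
    and le_c: "?c \<le> c"
    using assms(7) by (simp_all add: feasible_below_def)
  then have ne: "?F \<noteq> {}" and min_le: "Min (?f ` ?F) \<le> ?c"
    using assms(1,4-6) unfolding sequentially_improving_def partial_trajectory_def by blast+
  \<comment> \<open>With nonemptiness, this makes \<open>Min\<close> a genuine minimum and provides
    a minimizer, so that the step does not return \<open>None\<close>.\<close>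
  have fin: "finite ?F"
    using assms(3) by (simp add: feasible_ctrls_def)
  then obtain w where w: "is_arg_min ?f (\<lambda>v. v \<in> ?F) w"
    using ex_is_arg_min_if_finite[OF fin ne] by blast
  then have A: "?A \<noteq> {}"
    unfolding minimizing_ctrls_def by blast
  define v where "v = sel z ?A"
  have "v \<in> ?A"
    using assms(2) A unfolding tie_breaking_def v_def by blast
  then have v: "v \<in> ?F" and least: "\<And>v'. v' \<in> ?F \<Longrightarrow> ?f v \<le> ?f v'"
    unfolding minimizing_ctrls_def is_arg_min_linorder by auto
  have "?f v \<le> Min (?f ` ?F)"
    using least fin ne by simp
  with min_le le_c have "?f v \<le> c" by linarith
  moreover have "v \<in> ctrl_set P k l" and "candidate P R k l z v \<in> constraint_set P"
    using v by (simp_all add: feasible_ctrls_def)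
  \<comment> \<open>The candidate for \<open>v\<close> is by definition the completion of the
    successor, so its feasibility and cost bound are those the invariant asks for.\<close>
  ultimately have "feasible_below P R c (next_position (agents P) k l) (successor P k l z v)"
    using admissible_at_successor[OF assms(5,6) adm]
    by (auto simp: feasible_below_def candidate_def case_prod_beta)
  then show ?thesis
    using A by (simp add: rollout_step_def Let_def v_def)
qed

text \<open>Induction over the selections, each adding at most \<open>n\<close> runs. The case
  \<open>l = 0\<close> is separate because no selection has been made and the position is still
  \<open>(k, 1)\<close>.\<close>

lemma rollout_stage_feasible_below:
  assumes "sequentially_improving P R" "tie_breaking sel" "k < horizon P"
    and "\<And>l. l \<in> {1..agents P} \<Longrightarrow> finite (ctrl_set P k l) \<and> card (ctrl_set P k l) \<le> n"
    and "feasible_below P R c (k, 1) z" "l \<le> agents P"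
  shows "\<exists>z' Q. rollout_stage P R sel k z l = Some (z', Q) \<and>
    feasible_below P R c (if l = 0 then (k, 1) else next_position (agents P) k l) z' \<and>
    size Q \<le> n * l"
  using assms(6)
proof (induction l)
  case 0
  then show ?case using assms(5) by simp
next
  case (Suc l)
  then obtain z' Q where stage: "rollout_stage P R sel k z l = Some (z', Q)"
    and "feasible_below P R c (if l = 0 then (k, 1) else next_position (agents P) k l) z'"
    and Q: "size Q \<le> n * l"
    by auto
  \<comment> \<open>Since \<open>l < agents P\<close>, both branches of the conditional give the
    position \<open>(k, Suc l)\<close>.\<close>
  then have z': "feasible_below P R c (k, Suc l) z'"
    using Suc.prems by (simp add: next_position_def split: if_splits)
  have fin: "finite (ctrl_set P k (Suc l))" and card: "card (ctrl_set P k (Suc l)) \<le> n"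
    using assms(4)[of "Suc l"] Suc.prems by simp_all
  obtain z'' Q' where "rollout_step P R sel k (Suc l) z' = Some (z'', Q')"
    and "feasible_below P R c (next_position (agents P) k (Suc l)) z''"
    and "size Q' = card (ctrl_set P k (Suc l))"
    using rollout_step_feasible_below[OF assms(1,2) fin assms(3) _ Suc.prems z'] by auto
  then show ?case
    using stage Q card by simp
qed

lemma rollout_upto_feasible_below:
  assumes "sequentially_improving P R" "tie_breaking sel" "agents P \<ge> 1"
    and "\<And>k l. k < horizon P \<Longrightarrow> l \<in> {1..agents P} \<Longrightarrow>
           finite (ctrl_set P k l) \<and> card (ctrl_set P k l) \<le> n"
    and "feasible_below P R c (0, 1) (initial_trajectory P)" "k \<le> horizon P"
  shows "\<exists>z Qs. rollout_upto P R sel k = Some (z, Qs) \<and> feasible_below P R c (k, 1) z \<and>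
    length Qs = k \<and> (\<forall>i<k. size (Qs ! i) \<le> n * agents P)"
  using assms(6)
proof (induction k)
  case 0
  then show ?case using assms(5) by simp
next
  case (Suc k)
  then obtain z Qs where upto: "rollout_upto P R sel k = Some (z, Qs)"
    and z: "feasible_below P R c (k, 1) z" and len: "length Qs = k"
    and Qs: "\<forall>i<k. size (Qs ! i) \<le> n * agents P"
    by auto
  have k: "k < horizon P" using Suc.prems by simp
  obtain z' Q where stage: "rollout_stage P R sel k z (agents P) = Some (z', Q)"
    and "feasible_below P R c (if agents P = 0 then (k, 1) else next_position (agents P) k (agents P)) z'"
    and Q: "size Q \<le> n * agents P"
    using rollout_stage_feasible_below[OF assms(1,2) k assms(4)[OF k] z order.refl] by blast
  \<comment> \<open>With at least one agent, the position after component \<open>agents P\<close> is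
    the start of the next stage.\<close>
  then have "feasible_below P R c (Suc k, 1) z'"
    using assms(3) by (simp add: next_position_def)
  moreover have "\<forall>i<Suc k. size ((Qs @ [Q]) ! i) \<le> n * agents P"
    using Qs Q len by (auto simp: nth_append less_Suc_eq)
  ultimately show ?case
    using upto stage len by simp
qed

text \<open>The order \<open>O(nm)\<close> appears as the explicit bound \<open>n * agents P\<close>
  on the number of recorded runs in each stage; the result \<open>Some\<close> says that the
  algorithm never gets stuck.\<close>

theorem mainTheorem3:
  fixes P :: "('x, 'u) control_problem"
    and R :: "('x, 'u) trajectory \<Rightarrow> ('x, 'u) trajectory"
    and sel :: "('x, 'u) trajectory \<Rightarrow> 'u set \<Rightarrow> 'u"
    and n :: nat
  assumes "horizon P \<ge> 1" and "agents P \<ge> 1"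
    and "\<And>k l. k < horizon P \<Longrightarrow> l \<in> {1..agents P} \<Longrightarrow>
           finite (ctrl_set P k l) \<and> ctrl_set P k l \<noteq> {} \<and> card (ctrl_set P k l) \<le> n"
    and "constraint_set P \<subseteq> {T. complete_trajectory P T}"
    and "base_heuristic P R"
    and "sequentially_improving P R"
    and "heuristic_completion R (initial_trajectory P) \<in> constraint_set P"
    and "tie_breaking sel"
  shows "\<exists>y Qs. multiagent_rollout P R sel = Some (y, Qs) \<and>
           complete_trajectory P y \<and> y \<in> constraint_set P \<and>
           cost P y \<le> cost P (heuristic_completion R (initial_trajectory P)) \<and>
           length Qs = horizon P \<and>
           (\<forall>k < horizon P. size (Qs ! k) \<le> n * agents P)"
proof -
  let ?c = "cost P (heuristic_completion R (initial_trajectory P))"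
  \<comment> \<open>With \<open>c\<close> chosen as the cost of the initial completion, the
    invariant holds at the start with equality in its cost bound.\<close>
  have "feasible_below P R ?c (0, 1) (initial_trajectory P)"
    using assms(7) admissible_at_initial_trajectory by (simp add: feasible_below_def)
  then obtain y Qs where run: "rollout_upto P R sel (horizon P) = Some (y, Qs)"
    and y: "feasible_below P R ?c (horizon P, 1) y" and len: "length Qs = horizon P"
    and Qs: "\<forall>k<horizon P. size (Qs ! k) \<le> n * agents P"
    using rollout_upto_feasible_below[OF assms(6,8,2), of n ?c "horizon P"] assms(3) by auto
  have "complete_trajectory P y"
    using y by (simp add: feasible_below_def complete_trajectory_def)
  with y show ?thesis
    using run len Qs heuristic_completion_complete[OF assms(5)]
    by (simp add: feasible_below_def multiagent_rollout_def)
qed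

end
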